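(* Let $X_i\subseteq\mathbb{R}^n$ be a convex and closed set and $f_i:\mathbb{R}^n\to\mathbb{R}$ a convex function for $i=1,\dots,m$. Let $N=mn$, $X=X_1\times\dots\times X_m\subseteq\mathbb{R}^N$, let $f(x)=\sum_{i=1}^m f_i(x_i)$ for $x=(x_1,\dots,x_m)\in\mathbb{R}^N$, and let $p:\mathbb{R}^N\to\mathbb{R}$ be the cyclic penalty function $$p(x)=\frac{1}{2\tau}\left(\sum_{i=1}^{m-1}\|x_i-x_{i+1}\|^2+\|x_m-x_1\|^2\right)$$ with a fixed $\tau>0$. Suppose that the set $X^*(p)$ of minimizers of $p$ over $X$ is nonempty, and that $f$ is coercive on $X$. For a vector $e=(\varepsilon_1,\dots,\varepsilon_m)^\top$ with positive components consider the problem $$\min_{x\in X}\ \varphi(x,e),\qquad \varphi(x,e)=\sum_{i=1}^m\varepsilon_i f_i(x_i)+p(x). \qquad (\mathrm{P}_e)$$ Let $\{e^s\}$, $e^s=(\varepsilon^s_1,\dots,\varepsilon^s_m)^\top$, be a sequence of vectors with positive components such that $$\varepsilon^s_i\searrow 0\ \text{ as } s\to\infty,\quad i=1,\dots,m,\qquad \lim_{s\to\infty}\frac{\varepsilon^s_i}{\varepsilon^s_j}=1\quad\text{for all } i\neq j.$$ Then: (i) Problem $(\mathrm{P}_e)$ has a solution for each vector $e$ with positive components. (ii) Each sequence $\{z^s\}$, where $z^s$ is a solution of $(\mathrm{P}_{e})$ with $e=e^s$, has limit points, and all these limit points are solutions of the problem $$\min_{x\in X^*(p)} f(x).$$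
   Context: Vectors $x\in\mathbb{R}^N$, $N=mn$, are written in blocks $x=(x_1,\dots,x_m)$ with $x_i\in\mathbb{R}^n$; $\|\cdot\|$ is the Euclidean norm. A function $f$ is coercive on a set $X$ if $f(x)\to+\infty$ as $\|x\|\to\infty$, $x\in X$. $X^*(p)=\{x\in X: p(x)=\inf_{y\in X}p(y)\}$. The notation $\varepsilon^s_i\searrow 0$ means that the sequence $\{\varepsilon^s_i\}_s$ of positive numbers is nonincreasing and converges to $0$. A limit point of a sequence is the limit of some convergent subsequence. *)

theory Defs
  imports "HOL-Analysis.Analysis"
begin

text \<open>
  A vector of R^N, N = m n, is an element of \<open>real^'n^'m\<close>, with m = \<open>CARD('m)\<close> blocks
  \<open>x $ i\<close> in \<open>real^'n\<close>; the norm of this type is the Euclidean norm of R^N.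
  The index type carries no order, so the cyclic order of the blocks is supplied by a bijection
  \<open>\<iota>\<close> from \<open>{1..CARD('m)}\<close> onto \<open>'m\<close>: the k-th block of \<open>x\<close> is \<open>x $ \<iota> k\<close>.
\<close>

definition block_product :: "('m::finite \<Rightarrow> (real^'n) set) \<Rightarrow> (real^'n^'m) set" where
  "block_product X = {x. \<forall>i. x $ i \<in> X i}"

definition separable_sum :: "('m::finite \<Rightarrow> real^'n \<Rightarrow> real) \<Rightarrow> real^'n^'m \<Rightarrow> real" where
  "separable_sum f x = (\<Sum>i\<in>UNIV. f i (x $ i))"

definition cyclic_penalty :: "(nat \<Rightarrow> 'm::finite) \<Rightarrow> real \<Rightarrow> real^'n^'m \<Rightarrow> real" where
  "cyclic_penalty \<iota> \<tau> x =
     1 / (2 * \<tau>) * ((\<Sum>k = 1..CARD('m) - 1. (norm (x $ \<iota> k - x $ \<iota> (k + 1)))\<^sup>2)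
       + (norm (x $ \<iota> CARD('m) - x $ \<iota> 1))\<^sup>2)"

definition penalized_objective ::
  "('m::finite \<Rightarrow> real^'n \<Rightarrow> real) \<Rightarrow> (real^'n^'m \<Rightarrow> real) \<Rightarrow> real^'n^'m \<Rightarrow> real^'m \<Rightarrow> real" where
  "penalized_objective f p x e = (\<Sum>i\<in>UNIV. e $ i * f i (x $ i)) + p x"

definition coercive_on :: "'a::real_normed_vector set \<Rightarrow> ('a \<Rightarrow> real) \<Rightarrow> bool" where
  "coercive_on S g \<longleftrightarrow> filterlim g at_top (inf at_infinity (principal S))"

text \<open>
  The infimum is taken in the reals and is meaningful only for \<open>g\<close> bounded below on \<open>S\<close>,
  as is the nonnegative function \<open>cyclic_penalty \<iota> \<tau>\<close> for \<open>\<tau> > 0\<close>.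
\<close>

definition minimizers :: "'a set \<Rightarrow> ('a \<Rightarrow> real) \<Rightarrow> 'a set" where
  "minimizers S g = {x \<in> S. g x = (INF y\<in>S. g y)}"

definition seq_limit_point :: "(nat \<Rightarrow> 'a::topological_space) \<Rightarrow> 'a \<Rightarrow> bool" where
  "seq_limit_point z l \<longleftrightarrow> (\<exists>r. strict_mono r \<and> (z \<circ> r) \<longlonglongrightarrow> l)"

end

theory Submission
  imports Defs
begin

text \<open>
  Coercivity of the separable function f on the product X is the engine of the whole argument.
  A minimizer \<open>a\<close> of f over X exists, and because blocks can be exchanged one at a time inside a
  product, each block \<open>a $ i\<close> minimizes the single summand over its own factor. Hence
  every difference \<open>fi i (x $ i) - fi i (a $ i)\<close> is nonnegative on X, and a weighted sum of
  these differences dominates the unweighted one up to the smallest weight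
  (\<open>separable_le_weighted\<close>). Together with p being nonnegative, this bounds the sublevel sets of
  every penalized objective and gives the existence of solutions.

  For the limits, let \<open>y\<close> be any minimizer of p over X. Comparing the solution \<open>z s\<close> with \<open>y\<close>, the
  penalty of \<open>z s\<close> cannot be the smaller one, so the weighted sum of the summands at \<open>z s\<close> is at
  most the one at \<open>y\<close> (\<open>penalized_solution_weighted_le\<close>). Dividing by one of the weights leaves
  this comparison intact and turns the weights into ratios that tend to 1. Ratios close to 1 keep
  the solutions in one sublevel set of f, which is compact, and in the limit the inequality reads
  \<open>f l \<le> f y\<close>. Undivided, the weights tend to 0, so in the limit only
  \<open>p l \<le> p y\<close> is left of the optimality of \<open>z s\<close>, and \<open>l\<close> is itself a minimizer of p.

  All of this works for any continuous nonnegative penalty, of which the cyclic one is an instance;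
  convexity of the summands supplies their continuity.
\<close>

section \<open>Coercive functions and minimizers\<close>

lemma bounded_sublevel_coercive:
  fixes g :: "'a::real_normed_vector \<Rightarrow> real"
  assumes "coercive_on S g"
  shows "bounded {x \<in> S. g x \<le> c}"
proof -
  have "eventually (\<lambda>x. c < g x) (inf at_infinity (principal S))"
    using assms unfolding coercive_on_def filterlim_at_top_dense by blast
  then obtain b where "\<And>x. norm x \<ge> b \<Longrightarrow> x \<in> S \<Longrightarrow> c < g x"
    unfolding eventually_inf_principal eventually_at_infinity by blast
  then have "\<forall>x\<in>{x \<in> S. g x \<le> c}. norm x \<le> b"
    by (metis (mono_tags, lifting) linear mem_Collect_eq not_le)
  then show ?thesis unfolding bounded_iff by blast
qed

lemma compact_sublevel:
  fixes g :: "'a::heine_borel \<Rightarrow> real"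
  assumes "closed S" "continuous_on S g" "bounded {x \<in> S. g x \<le> c}"
  shows "compact {x \<in> S. g x \<le> c}"
  using assms by (simp add: compact_eq_bounded_closed continuous_on_closed_Collect_le)

lemma arg_min_exists_if_bounded_sublevel:
  fixes g :: "'a::heine_borel \<Rightarrow> real"
  assumes "closed S" "continuous_on S g" "y \<in> S" "bounded {x \<in> S. g x \<le> g y}"
  shows "\<exists>x. is_arg_min g (\<lambda>x. x \<in> S) x"
proof -
  let ?K = "{x \<in> S. g x \<le> g y}"
  have "compact ?K" using assms by (intro compact_sublevel)
  moreover have "?K \<noteq> {}" "continuous_on ?K g"
    using assms by (auto intro: continuous_on_subset)
  ultimately obtain x where x: "x \<in> ?K" "\<forall>u\<in>?K. g x \<le> g u"
    using continuous_attains_inf[of ?K g] by auto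
  then have "\<forall>u\<in>S. g x \<le> g u" by fastforce
  with x(1) show ?thesis unfolding is_arg_min_linorder by blast
qed

lemma minimizers_iff:
  fixes g :: "'a \<Rightarrow> real"
  assumes "bdd_below (g ` S)"
  shows "x \<in> minimizers S g \<longleftrightarrow> x \<in> S \<and> (\<forall>y\<in>S. g x \<le> g y)"
proof
  assume "x \<in> minimizers S g"
  then show "x \<in> S \<and> (\<forall>y\<in>S. g x \<le> g y)"
    using assms by (auto simp: minimizers_def intro: cINF_lower)
next
  assume "x \<in> S \<and> (\<forall>y\<in>S. g x \<le> g y)"
  then show "x \<in> minimizers S g"
    using assms by (auto simp: minimizers_def intro!: antisym cINF_lower cINF_greatest)
qed

section \<open>Separable objectives with a nonnegative penalty\<close>

locale penalized_separable_problem =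
  fixes Xi :: "'m::finite \<Rightarrow> (real^'n) set"
    and fi :: "'m \<Rightarrow> real^'n \<Rightarrow> real"
    and p :: "real^'n^'m \<Rightarrow> real"
  assumes closed_factor: "closed (Xi i)"
    and continuous_summand: "continuous_on UNIV (fi i)"
    and continuous_penalty: "continuous_on UNIV p"
    and penalty_nonneg: "0 \<le> p x"
    and product_nonempty: "block_product Xi \<noteq> {}"
    and coercive: "coercive_on (block_product Xi) (separable_sum fi)"
begin

abbreviation "X \<equiv> block_product Xi"
abbreviation "f \<equiv> separable_sum fi"

lemma closed_product: "closed X"
proof -
  have "X = (\<Inter>i. (\<lambda>x. x $ i) -` Xi i)" by (auto simp: block_product_def)
  then show ?thesis
    by (simp only:) (intro closed_INT ballI closed_vimage closed_factor continuous_intros)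
qed

lemma continuous_block: "continuous_on A (\<lambda>x. fi i (x $ i))"
  by (rule continuous_on_compose2[OF continuous_summand]) (auto intro!: continuous_intros)

lemma tendsto_block:
  assumes "(u \<longlongrightarrow> l) F"
  shows "((\<lambda>s. fi i (u s $ i)) \<longlongrightarrow> fi i (l $ i)) F"
  using continuous_on_tendsto_compose[OF continuous_block[of UNIV i] assms] by simp

lemma continuous_separable_sum: "continuous_on A f"
  unfolding separable_sum_def by (intro continuous_on_sum continuous_block)

lemma continuous_penalized_objective: "continuous_on A (\<lambda>x. penalized_objective fi p x e)"
  unfolding penalized_objective_def
  by (intro continuous_intros continuous_block continuous_on_subset[OF continuous_penalty]) auto

lemma minimizers_penalty_iff: "x \<in> minimizers X p \<longleftrightarrow> x \<in> X \<and> (\<forall>y\<in>X. p x \<le> p y)"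
  by (intro minimizers_iff bdd_belowI2[of _ 0] penalty_nonneg)

text \<open>
  A minimizer of f over the product is optimal in each block separately: replacing a single block
  stays inside the product and changes only one summand.
\<close>

lemma blockwise_minimizer_exists:
  obtains a where "a \<in> X" "\<And>i v. v \<in> Xi i \<Longrightarrow> fi i (a $ i) \<le> fi i v"
proof -
  obtain y where "y \<in> X" using product_nonempty by blast
  then have "\<exists>a. is_arg_min f (\<lambda>x. x \<in> X) a"
    using closed_product continuous_separable_sum bounded_sublevel_coercive[OF coercive]
    by (blast intro: arg_min_exists_if_bounded_sublevel)
  then obtain a where a: "a \<in> X" "\<And>x. x \<in> X \<Longrightarrow> f a \<le> f x"
    unfolding is_arg_min_linorder by blast
  have "fi i (a $ i) \<le> fi i v" if "v \<in> Xi i" for i v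
  proof -
    let ?x = "\<chi> j. if j = i then v else a $ j"
    have "?x \<in> X" using a(1) that by (simp add: block_product_def)
    then have "f a \<le> f ?x" by (rule a(2))
    moreover have "f u = fi i (u $ i) + (\<Sum>j\<in>UNIV - {i}. fi j (u $ j))" for u
      unfolding separable_sum_def by (intro sum.remove) auto
    moreover have "(\<Sum>j\<in>UNIV - {i}. fi j (?x $ j)) = (\<Sum>j\<in>UNIV - {i}. fi j (a $ j))"
      by (intro sum.cong) auto
    ultimately show ?thesis by simp
  qed
  with a(1) that show thesis by blast
qed

text \<open>
  Measured from the blockwise minimizer all differences are nonnegative, so lowering every weight
  to the common bound \<open>c\<close> can only decrease the weighted sum.
\<close>

lemma separable_le_weighted:
  assumes "\<And>i v. v \<in> Xi i \<Longrightarrow> fi i (a $ i) \<le> fi i v" "x \<in> X" "\<And>i. c \<le> w i"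
  shows "c * (f x - f a) \<le> (\<Sum>i\<in>UNIV. w i * (fi i (x $ i) - fi i (a $ i)))"
proof -
  have "c * (f x - f a) = (\<Sum>i\<in>UNIV. c * (fi i (x $ i) - fi i (a $ i)))"
    by (simp add: separable_sum_def sum_distrib_left flip: sum_subtractf)
  also have "\<dots> \<le> (\<Sum>i\<in>UNIV. w i * (fi i (x $ i) - fi i (a $ i)))"
    using assms by (intro sum_mono mult_right_mono) (auto simp: block_product_def)
  finally show ?thesis .
qed

text \<open>
  This is the form in which coercivity is used below: a bound on the weighted sum
  confines \<open>x\<close> to a sublevel set of f that depends on the weights only through \<open>c\<close>.
\<close>

lemma separable_le_if_weighted_le:
  assumes a: "\<And>i v. v \<in> Xi i \<Longrightarrow> fi i (a $ i) \<le> fi i v"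
    and "x \<in> X" "0 < c" "\<And>i. c \<le> w i"
    and "(\<Sum>i\<in>UNIV. w i * (fi i (x $ i) - fi i (a $ i))) \<le> b"
  shows "f x \<le> f a + b / c"
proof -
  have "c * (f x - f a) \<le> b"
    using separable_le_weighted[of a x c w, OF a] assms by fastforce
  with \<open>0 < c\<close> show ?thesis by (simp add: field_simps)
qed

lemma penalized_solution_exists:
  assumes "\<And>i. 0 < e $ i"
  shows "\<exists>x. is_arg_min (\<lambda>x. penalized_objective fi p x e) (\<lambda>x. x \<in> X) x"
proof -
  obtain a where a: "a \<in> X" "\<And>i v. v \<in> Xi i \<Longrightarrow> fi i (a $ i) \<le> fi i v"
    using blockwise_minimizer_exists by blast
  define c where "c = Min (range (\<lambda>i. e $ i))"
  have c: "0 < c" "\<And>i. c \<le> e $ i"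
    using assms by (auto simp: c_def)
  have "{x \<in> X. penalized_objective fi p x e \<le> penalized_objective fi p a e}
      \<subseteq> {x \<in> X. f x \<le> f a + p a / c}"
  proof safe
    fix x assume x: "x \<in> X" "penalized_objective fi p x e \<le> penalized_objective fi p a e"
    then have "(\<Sum>i\<in>UNIV. e $ i * (fi i (x $ i) - fi i (a $ i))) \<le> p a"
      using penalty_nonneg[of x]
      by (simp add: penalized_objective_def right_diff_distrib sum_subtractf)
    with x(1) c show "f x \<le> f a + p a / c"
      by (intro separable_le_if_weighted_le[where w = "\<lambda>i. e $ i"] a(2)) auto
  qed
  then have "bounded {x \<in> X. penalized_objective fi p x e \<le> penalized_objective fi p a e}"
    using bounded_sublevel_coercive[OF coercive] bounded_subset by blast
  with closed_product a(1) show ?thesis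
    by (intro arg_min_exists_if_bounded_sublevel continuous_penalized_objective)
qed

section \<open>Vanishing weights with equal asymptotics\<close>

lemma penalized_solution_weighted_le:
  assumes "is_arg_min (\<lambda>x. penalized_objective fi p x e) (\<lambda>x. x \<in> X) z"
    and "y \<in> minimizers X p"
  shows "(\<Sum>i\<in>UNIV. e $ i * fi i (z $ i)) \<le> (\<Sum>i\<in>UNIV. e $ i * fi i (y $ i))"
proof -
  have "y \<in> X" "z \<in> X"
    using assms unfolding is_arg_min_def minimizers_def by blast+
  then have "penalized_objective fi p z e \<le> penalized_objective fi p y e" "p y \<le> p z"
    using assms unfolding is_arg_min_linorder minimizers_penalty_iff by blast+
  then show ?thesis by (simp add: penalized_objective_def)
qed

context
  fixes \<epsilon> :: "nat \<Rightarrow> real^'m" and z :: "nat \<Rightarrow> real^'n^'m"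
  assumes weight_pos: "0 < \<epsilon> s $ i"
    and weight_ratio: "i \<noteq> j \<Longrightarrow> (\<lambda>s. \<epsilon> s $ i / \<epsilon> s $ j) \<longlonglongrightarrow> 1"
    and solution: "is_arg_min (\<lambda>x. penalized_objective fi p x (\<epsilon> s)) (\<lambda>x. x \<in> X) (z s)"
begin

lemma solution_mem: "z s \<in> X"
  using solution unfolding is_arg_min_def by blast

lemma weight_ratio_tendsto: "(\<lambda>s. \<epsilon> s $ i / \<epsilon> s $ j) \<longlonglongrightarrow> 1"
proof (cases "i = j")
  case True
  moreover have "\<epsilon> s $ j / \<epsilon> s $ j = 1" for s using weight_pos[of s j] by simp
  ultimately show ?thesis by simp
qed (rule weight_ratio)

lemma ratio_weighted_le:
  assumes "y \<in> minimizers X p"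
  shows "(\<Sum>i\<in>UNIV. \<epsilon> s $ i / \<epsilon> s $ j * fi i (z s $ i))
    \<le> (\<Sum>i\<in>UNIV. \<epsilon> s $ i / \<epsilon> s $ j * fi i (y $ i))"
proof -
  have "(\<Sum>i\<in>UNIV. \<epsilon> s $ i * fi i (z s $ i)) / \<epsilon> s $ j
      \<le> (\<Sum>i\<in>UNIV. \<epsilon> s $ i * fi i (y $ i)) / \<epsilon> s $ j"
    using penalized_solution_weighted_le[OF solution assms] weight_pos[of s j]
    by (simp add: divide_right_mono)
  then show ?thesis by (simp add: sum_divide_distrib)
qed

text \<open>
  Once all ratios are at least \<open>1/2\<close>, and the weighted sum at the comparison point is within 1 of
  its limit, the solutions lie in a fixed compact sublevel set of f.
\<close>

lemma solutions_have_limit_point: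
  assumes y: "y \<in> minimizers X p"
  shows "\<exists>l. seq_limit_point z l"
proof -
  obtain a where a: "a \<in> X" "\<And>i v. v \<in> Xi i \<Longrightarrow> fi i (a $ i) \<le> fi i v"
    using blockwise_minimizer_exists by blast
  \<comment> \<open>the block whose weight serves as the common divisor; any choice will do\<close>
  fix j :: 'm
  define w where "w s i = \<epsilon> s $ i / \<epsilon> s $ j" for s i
  have w: "(\<lambda>s. w s i) \<longlonglongrightarrow> 1" for i
    unfolding w_def by (rule weight_ratio_tendsto)
  have "(\<lambda>s. \<Sum>i\<in>UNIV. w s i * (fi i (y $ i) - fi i (a $ i)))
      \<longlonglongrightarrow> (\<Sum>i\<in>UNIV. 1 * (fi i (y $ i) - fi i (a $ i)))"
    by (intro tendsto_intros w)
  then have "(\<lambda>s. \<Sum>i\<in>UNIV. w s i * (fi i (y $ i) - fi i (a $ i))) \<longlonglongrightarrow> f y - f a"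
    by (simp add: separable_sum_def sum_subtractf)
  then have "\<forall>\<^sub>F s in sequentially.
      (\<Sum>i\<in>UNIV. w s i * (fi i (y $ i) - fi i (a $ i))) < f y - f a + 1"
    by (rule order_tendstoD) simp
  moreover have "\<forall>\<^sub>F s in sequentially. \<forall>i. 1/2 < w s i"
    by (intro eventually_all_finite order_tendstoD(1)[OF w]) simp
  ultimately have "\<forall>\<^sub>F s in sequentially. f (z s) \<le> f a + (f y - f a + 1) / (1/2)"
  proof eventually_elim
    case (elim s)
    have "(\<Sum>i\<in>UNIV. w s i * (fi i (z s $ i) - fi i (a $ i)))
        \<le> (\<Sum>i\<in>UNIV. w s i * (fi i (y $ i) - fi i (a $ i)))"
      using ratio_weighted_le[OF y, of s j]
      by (simp add: w_def right_diff_distrib sum_subtractf)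
    with elim have "(\<Sum>i\<in>UNIV. w s i * (fi i (z s $ i) - fi i (a $ i))) \<le> f y - f a + 1"
      by linarith
    with elim(2) show ?case
      by (intro separable_le_if_weighted_le[where w = "w s"] a(2) solution_mem)
        (auto intro: less_imp_le)
  qed
  then obtain k where k: "\<And>s. s \<ge> k \<Longrightarrow> f (z s) \<le> f a + (f y - f a + 1) / (1/2)"
    unfolding eventually_sequentially by blast
  let ?K = "{x \<in> X. f x \<le> f a + (f y - f a + 1) / (1/2)}"
  have "seq_compact ?K"
    unfolding compact_eq_seq_compact_metric[symmetric]
    by (intro compact_sublevel closed_product continuous_separable_sum
        bounded_sublevel_coercive coercive)
  moreover have "\<forall>s. z (s + k) \<in> ?K"
    using k solution_mem by simp
  ultimately obtain l r where "l \<in> ?K"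
    and r: "strict_mono r" "((\<lambda>s. z (s + k)) \<circ> r) \<longlonglongrightarrow> l"
    by (rule seq_compactE)
  have "strict_mono (\<lambda>s. r s + k)" using r(1) by (simp add: strict_mono_def)
  with r(2) show ?thesis unfolding seq_limit_point_def by (auto simp: o_def)
qed

lemma limit_point_separable_le:
  assumes "seq_limit_point z l" and y: "y \<in> minimizers X p"
  shows "f l \<le> f y"
proof -
  obtain r where r: "strict_mono r" "(z \<circ> r) \<longlonglongrightarrow> l"
    using assms(1) unfolding seq_limit_point_def by blast
  \<comment> \<open>the block whose weight serves as the common divisor; any choice will do\<close>
  fix j :: 'm
  have w: "(\<lambda>s. \<epsilon> (r s) $ i / \<epsilon> (r s) $ j) \<longlonglongrightarrow> 1" for i
    using LIMSEQ_subseq_LIMSEQ[OF weight_ratio_tendsto r(1)] by (simp add: o_def)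
  have "(\<lambda>s. \<Sum>i\<in>UNIV. \<epsilon> (r s) $ i / \<epsilon> (r s) $ j * fi i ((z \<circ> r) s $ i))
      \<longlonglongrightarrow> (\<Sum>i\<in>UNIV. 1 * fi i (l $ i))"
    by (intro tendsto_intros w tendsto_block r(2))
  moreover have "(\<lambda>s. \<Sum>i\<in>UNIV. \<epsilon> (r s) $ i / \<epsilon> (r s) $ j * fi i (y $ i))
      \<longlonglongrightarrow> (\<Sum>i\<in>UNIV. 1 * fi i (y $ i))"
    by (intro tendsto_intros w)
  ultimately have "(\<Sum>i\<in>UNIV. 1 * fi i (l $ i)) \<le> (\<Sum>i\<in>UNIV. 1 * fi i (y $ i))"
    by (rule LIMSEQ_le) (use ratio_weighted_le[OF y] in auto)
  then show ?thesis by (simp add: separable_sum_def)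
qed

lemma limit_point_minimizes_penalty:
  assumes "seq_limit_point z l" and y: "y \<in> minimizers X p"
    and weight_null: "\<And>i. (\<lambda>s. \<epsilon> s $ i) \<longlonglongrightarrow> 0"
  shows "l \<in> minimizers X p"
proof -
  obtain r where r: "strict_mono r" "(z \<circ> r) \<longlonglongrightarrow> l"
    using assms(1) unfolding seq_limit_point_def by blast
  have null: "(\<lambda>s. \<epsilon> (r s) $ i) \<longlonglongrightarrow> 0" for i
    using LIMSEQ_subseq_LIMSEQ[OF weight_null r(1)] by (simp add: o_def)
  have p: "(\<lambda>s. p ((z \<circ> r) s)) \<longlonglongrightarrow> p l"
    using continuous_on_tendsto_compose[OF continuous_penalty r(2)] by simp
  have "(\<lambda>s. penalized_objective fi p ((z \<circ> r) s) (\<epsilon> (r s)))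
      \<longlonglongrightarrow> (\<Sum>i\<in>UNIV. 0 * fi i (l $ i)) + p l"
    unfolding penalized_objective_def by (intro tendsto_intros null tendsto_block r(2) p)
  moreover have "(\<lambda>s. penalized_objective fi p y (\<epsilon> (r s)))
      \<longlonglongrightarrow> (\<Sum>i\<in>UNIV. 0 * fi i (y $ i)) + p y"
    unfolding penalized_objective_def by (intro tendsto_intros null)
  moreover have "penalized_objective fi p ((z \<circ> r) s) (\<epsilon> (r s))
      \<le> penalized_objective fi p y (\<epsilon> (r s))" for s
    using solution y unfolding is_arg_min_linorder minimizers_penalty_iff by simp
  then have "\<exists>N. \<forall>s\<ge>N. penalized_objective fi p ((z \<circ> r) s) (\<epsilon> (r s))
      \<le> penalized_objective fi p y (\<epsilon> (r s))" by blast
  ultimately have "(\<Sum>i\<in>UNIV. 0 * fi i (l $ i)) + p l \<le> (\<Sum>i\<in>UNIV. 0 * fi i (y $ i)) + p y"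
    by (rule LIMSEQ_le)
  then have "p l \<le> p y" by simp
  moreover have "l \<in> X"
    using closed_sequentially[OF closed_product _ r(2)] solution_mem by simp
  ultimately show ?thesis
    using y unfolding minimizers_penalty_iff by force
qed

end

end

section \<open>The cyclic penalty\<close>

lemma cyclic_penalty_nonneg: "0 < \<tau> \<Longrightarrow> 0 \<le> cyclic_penalty \<iota> \<tau> x"
  unfolding cyclic_penalty_def
  by (intro mult_nonneg_nonneg add_nonneg_nonneg sum_nonneg zero_le_power2) simp

lemma continuous_on_cyclic_penalty: "continuous_on A (cyclic_penalty \<iota> \<tau>)"
  unfolding cyclic_penalty_def by (intro continuous_intros)

theorem theorem1:
  fixes \<iota> :: "nat \<Rightarrow> 'm::finite"
    and Xi :: "'m \<Rightarrow> (real^'n) set"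
    and fi :: "'m \<Rightarrow> real^'n \<Rightarrow> real"
    and \<tau> :: real
    and X :: "(real^'n^'m) set"
    and f p :: "real^'n^'m \<Rightarrow> real"
    and \<phi> :: "real^'n^'m \<Rightarrow> real^'m \<Rightarrow> real"
    and \<epsilon> :: "nat \<Rightarrow> real^'m"
  defines "X \<equiv> block_product Xi"
    and "f \<equiv> separable_sum fi"
    and "p \<equiv> cyclic_penalty \<iota> \<tau>"
    and "\<phi> \<equiv> penalized_objective fi p"
  assumes "bij_betw \<iota> {1..CARD('m)} UNIV"
    and "\<And>i. convex (Xi i)" and "\<And>i. closed (Xi i)"
    and "\<And>i. convex_on UNIV (fi i)"
    and "\<tau> > 0"
    and "minimizers X p \<noteq> {}"
    and "coercive_on X f"
    and "\<And>s i. \<epsilon> s $ i > 0"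
    and "\<And>i. decseq (\<lambda>s. \<epsilon> s $ i)"
    and "\<And>i. (\<lambda>s. \<epsilon> s $ i) \<longlonglongrightarrow> 0"
    and "\<And>i j. i \<noteq> j \<Longrightarrow> (\<lambda>s. \<epsilon> s $ i / \<epsilon> s $ j) \<longlonglongrightarrow> 1"
  shows "(\<forall>e. (\<forall>i. e $ i > 0) \<longrightarrow> (\<exists>x. is_arg_min (\<lambda>x. \<phi> x e) (\<lambda>x. x \<in> X) x)) \<and>
    (\<forall>z. (\<forall>s. is_arg_min (\<lambda>x. \<phi> x (\<epsilon> s)) (\<lambda>x. x \<in> X) (z s)) \<longrightarrow>
      (\<exists>l. seq_limit_point z l) \<and>
      (\<forall>l. seq_limit_point z l \<longrightarrow> is_arg_min f (\<lambda>x. x \<in> minimizers X p) l))"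
proof -
  interpret penalized_separable_problem Xi fi p
  proof
    show "continuous_on UNIV (fi i)" for i
      using assms(8) by (intro convex_on_continuous) auto
    show "block_product Xi \<noteq> {}"
      using assms(10) by (auto simp: X_def minimizers_def)
  qed (use assms in \<open>auto simp: continuous_on_cyclic_penalty cyclic_penalty_nonneg\<close>)
  show ?thesis
  proof (intro conjI allI impI)
    fix e :: "real^'m" assume "\<forall>i. e $ i > 0"
    then show "\<exists>x. is_arg_min (\<lambda>x. \<phi> x e) (\<lambda>x. x \<in> X) x"
      using penalized_solution_exists by (simp add: X_def \<phi>_def)
  next
    fix z assume z: "\<forall>s. is_arg_min (\<lambda>x. \<phi> x (\<epsilon> s)) (\<lambda>x. x \<in> X) (z s)"
    obtain y where y: "y \<in> minimizers (block_product Xi) p"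
      using assms(10) by (auto simp: X_def)
    have sol: "is_arg_min (\<lambda>x. penalized_objective fi p x (\<epsilon> s))
        (\<lambda>x. x \<in> block_product Xi) (z s)" for s
      using z by (simp add: X_def \<phi>_def)
    show "\<exists>l. seq_limit_point z l"
      by (rule solutions_have_limit_point[OF assms(12,15) sol y])
    fix l assume l: "seq_limit_point z l"
    show "is_arg_min f (\<lambda>x. x \<in> minimizers X p) l"
      using limit_point_minimizes_penalty[OF assms(12,15) sol l y assms(14)]
        limit_point_separable_le[OF assms(12,15) sol l]
      by (simp add: is_arg_min_linorder X_def f_def)
  qed
qed

end
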